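(* Let $n\geq 2$ be an integer and let $G:\mathbb{F}_{3^n}\to\mathbb{F}_{3^n}$, $G(x)=x^{\frac{3^n+3}{2}}$. If $c=-1$, then $G$ is PcN (that is, ${}_{-1}\Delta_G=1$) if $n$ is odd, and $G$ is APcN (that is, ${}_{-1}\Delta_G=2$) if $n$ is even. If $c=1$, then the differential uniformity of $G$ is ${}_1\Delta_G=1$ if $n$ is even, and ${}_1\Delta_G=4$ if $n$ is odd.
   Context: Let $p$ be a prime, $n$ a positive integer, and $\mathbb{F}_{p^n}$ the finite field with $p^n$ elements. For a function $F:\mathbb{F}_{p^n}\to\mathbb{F}_{p^n}$ and $a,b,c\in\mathbb{F}_{p^n}$, let ${}_c\Delta_F(a,b)=|\{x\in\mathbb{F}_{p^n} : F(x+a)-cF(x)=b\}|$. The $c$-differential uniformity of $F$ is ${}_c\Delta_F=\max\{{}_c\Delta_F(a,b) : a,b\in\mathbb{F}_{p^n},\ \text{and } a\neq 0 \text{ if } c=1\}$ (so for $c\neq 1$ the value $a=0$ is allowed; for $c=1$ this is the usual differential uniformity). $F$ is called perfect $c$-nonlinear (PcN) if ${}_c\Delta_F=1$, and almost perfect $c$-nonlinear (APcN) if ${}_c\Delta_F=2$. *)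

theory Defs
  imports Main "HOL-Library.Cardinality"
begin

definition c_diff_count :: "'a \<Rightarrow> ('a::{field,finite} \<Rightarrow> 'a) \<Rightarrow> 'a \<Rightarrow> 'a \<Rightarrow> nat" where
  "c_diff_count c F a b = card {x. F (x + a) - c * F x = b}"

(* The shift a = 0 is excluded only for c = 1. *)
definition c_diff_uniformity :: "'a \<Rightarrow> ('a::{field,finite} \<Rightarrow> 'a) \<Rightarrow> nat" where
  "c_diff_uniformity c F = Max {c_diff_count c F a b | a b. c = 1 \<longrightarrow> a \<noteq> 0}"

definition PcN :: "'a \<Rightarrow> ('a::{field,finite} \<Rightarrow> 'a) \<Rightarrow> bool" where
  "PcN c F \<longleftrightarrow> c_diff_uniformity c F = 1"

definition APcN :: "'a \<Rightarrow> ('a::{field,finite} \<Rightarrow> 'a) \<Rightarrow> bool" where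
  "APcN c F \<longleftrightarrow> c_diff_uniformity c F = 2"

end

theory Submission
  imports Defs
begin

text \<open>
  Write \<open>\<chi> x = x ^ ((3 ^ n - 1) div 2)\<close>, so that \<open>G x = \<chi> x * x\<^sup>2\<close>. As \<open>G\<close> is multiplicative, every
  shift \<open>a \<noteq> 0\<close> reduces to \<open>a = 1\<close>. Fix the signs \<open>\<chi> (x + 1)\<close> and \<open>\<chi> x\<close>: then the equation
  \<open>G (x + 1) - c * G x = b\<close> is linear, with solution \<open>1 - \<epsilon> * b\<close>, or quadratic, of the form
  \<open>(x - 1)\<^sup>2 = - 1 - \<epsilon> * b\<close>, where \<open>\<epsilon> = \<chi> (x + 1)\<close>. Each of the possible kinds of solution
  prescribes the values \<open>\<chi> (1 - b)\<close> and \<open>\<chi> (1 + b)\<close>. For \<open>c = \<chi> (- 1)\<close> these prescriptions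
  exclude each other and there is at most one solution. For \<open>c = - \<chi> (- 1)\<close> the two quadratic
  equations may be solvable together only if \<open>\<chi> (- 1) = - 1\<close>, and then a rational parametrisation of
  the circle \<open>s\<^sup>2 + t\<^sup>2 = 1\<close> yields a value \<open>b\<close> with four solutions.
\<close>

section \<open>Uniformity as a maximum, and the reduction to shift 1\<close>

lemma c_diff_uniformity_eqI:
  assumes upper: "\<And>a b. (c = 1 \<Longrightarrow> a \<noteq> 0) \<Longrightarrow> c_diff_count c F a b \<le> k"
    and attained: "c = 1 \<Longrightarrow> a \<noteq> 0" "k \<le> c_diff_count c F a b"
  shows "c_diff_uniformity c F = k"
  unfolding c_diff_uniformity_def
proof (rule Max_eqI)
  have "{c_diff_count c F a b | a b. c = 1 \<longrightarrow> a \<noteq> 0} \<subseteq> {..k}"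
    using upper by auto
  then show "finite {c_diff_count c F a b | a b. c = 1 \<longrightarrow> a \<noteq> 0}"
    by (rule finite_subset) simp
  show "k \<in> {c_diff_count c F a b | a b. c = 1 \<longrightarrow> a \<noteq> 0}"
    using attained upper[of a b] le_antisym by blast
qed (use upper in auto)

text \<open>The substitution \<open>x = a * y\<close> pulls the factor \<open>F a\<close> out of
  both terms of the difference.\<close>

lemma c_diff_count_shift_one:
  fixes F :: "'a::{field,finite} \<Rightarrow> 'a"
  assumes mult: "\<And>x y. F (x * y) = F x * F y" and "a \<noteq> 0" "F a \<noteq> 0"
  shows "c_diff_count c F a b = c_diff_count c F 1 (b / F a)"
proof -
  have "F (a * y + a) - c * F (a * y) = F a * (F (y + 1) - c * F y)" for y
    using mult[of a "y + 1"] mult[of a y] by (simp add: algebra_simps)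
  then have scale: "F (a * y + a) - c * F (a * y) = b \<longleftrightarrow> F (y + 1) - c * F y = b / F a" for y
    using \<open>F a \<noteq> 0\<close> by (simp add: eq_divide_eq mult.commute[of a] mult.commute[of _ "F a"])
  have "bij_betw ((*) a) {y. F (y + 1) - c * F y = b / F a} {x. F (x + a) - c * F x = b}"
    unfolding scale[symmetric]
    by (rule bij_betw_byWitness[where f' = "\<lambda>x. x / a"]) (use \<open>a \<noteq> 0\<close> in auto)
  then show ?thesis
    unfolding c_diff_count_def by (simp add: bij_betw_same_card)
qed

lemma card_le_one_if_unique:
  assumes "\<And>x y. x \<in> A \<Longrightarrow> y \<in> A \<Longrightarrow> x = y"
  shows "card A \<le> 1"
proof (cases "finite A")
  case True
  then show ?thesis
    using card_le_Suc0_iff_eq assms by (metis One_nat_def)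
qed simp

lemma card_square_roots_le_2: "card {x :: 'a::{field,finite}. (x - u)\<^sup>2 = d} \<le> 2"
proof (cases "\<exists>r. (r - u)\<^sup>2 = d")
  case True
  then obtain r where "(r - u)\<^sup>2 = d" by blast
  then have "{x. (x - u)\<^sup>2 = d} \<subseteq> {r, 2 * u - r}"
    by (auto simp: power2_eq_iff algebra_simps)
  then have "card {x. (x - u)\<^sup>2 = d} \<le> card {r, 2 * u - r}"
    by (rule card_mono[rotated]) simp
  also have "\<dots> \<le> 2"
    by (simp add: card_insert_if)
  finally show ?thesis .
qed simp

section \<open>Fermat's identity and the characteristic of a finite field\<close>

lemma finite_field_power_card_minus_one:
  fixes a :: "'a::{field,finite}"
  assumes "a \<noteq> 0"
  shows "a ^ (CARD('a) - 1) = 1"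
proof -
  \<comment> \<open>Multiplication by \<open>a\<close> permutes the nonzero elements, so their
    product does not change.\<close>
  have "(\<Prod>x\<in>UNIV - {0}. a * x) = \<Prod>(UNIV - {0 :: 'a})"
    by (rule prod.reindex_bij_witness[of _ "\<lambda>x. x / a" "\<lambda>x. a * x"]) (use assms in auto)
  then have "a ^ (CARD('a) - 1) * \<Prod>(UNIV - {0 :: 'a}) = \<Prod>(UNIV - {0})"
    by (simp add: prod.distrib card_Diff_singleton)
  moreover have "\<Prod>(UNIV - {0 :: 'a}) \<noteq> 0"
    by simp
  ultimately show ?thesis
    by simp
qed

text \<open>Translation by 1 permutes the field, so the sum of all elements absorbs one extra 1 for
  each element.\<close>

lemma of_nat_CARD_eq_0: "of_nat CARD('a) = (0 :: 'a::{field,finite})"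
proof -
  have "(\<Sum>x\<in>UNIV. x + 1 :: 'a) = \<Sum>UNIV"
    by (rule sum.reindex_bij_witness[of _ "\<lambda>x. x - 1" "\<lambda>x. x + 1"]) auto
  then show ?thesis
    by (simp add: sum.distrib)
qed

section \<open>The quadratic character in characteristic 3\<close>

locale ternary_quadratic_character =
  fixes \<chi> :: "'a::{field,finite} \<Rightarrow> 'a"
  assumes three: "(3 :: 'a) = 0"
    and chi_mult: "\<chi> (x * y) = \<chi> x * \<chi> y"
    and chi_0 [simp]: "\<chi> 0 = 0"
    and chi_sign: "x \<noteq> 0 \<Longrightarrow> \<chi> x = 1 \<or> \<chi> x = - 1"
begin

definition signed_square :: "'a \<Rightarrow> 'a" where
  "signed_square x = \<chi> x * x\<^sup>2"

lemma one_neq_minus_one [simp]: "(1 :: 'a) \<noteq> - 1" "(- 1 :: 'a) \<noteq> 1"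
proof -
  have "(1 :: 'a) + (1 + 1) = 0"
    using three by simp
  then show "(1 :: 'a) \<noteq> - 1"
    by (metis add.right_inverse add.right_neutral zero_neq_one)
  then show "(- 1 :: 'a) \<noteq> 1" by metis
qed

text \<open>Makes an identity modulo 3 accessible to \<open>algebra\<close>: with the multiple of 3
  written out as \<open>3 * k\<close>, it holds in every commutative ring. The witnesses
  \<open>k\<close> below are these quotients.\<close>

lemma eqI_mod_3: "x = y + 3 * k \<Longrightarrow> x = (y :: 'a)"
  by (simp add: three)

lemma two [simp]: "(2 :: 'a) = - 1"
  by (rule eqI_mod_3[where k = 1]) simp

lemma chi_eq_0_iff [simp]: "\<chi> x = 0 \<longleftrightarrow> x = 0"
  using chi_sign[of x] by (cases "x = 0") auto

lemma chi_1 [simp]: "\<chi> 1 = 1"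
  using chi_mult[of 1 1] chi_eq_0_iff[of 1] by simp

lemma chi_square [simp]: "x \<noteq> 0 \<Longrightarrow> \<chi> (x\<^sup>2) = 1"
  using chi_sign[of x] by (auto simp: power2_eq_square chi_mult)

lemma chi_minus: "\<chi> (- x) = \<chi> (- 1) * \<chi> x"
  using chi_mult[of "- 1" x] by simp

lemma chi_minus_1_sign: "\<chi> (- 1) = 1 \<or> \<chi> (- 1) = - 1"
  by (simp add: chi_sign)

lemma signed_square_mult: "signed_square (x * y) = signed_square x * signed_square y"
  by (simp add: signed_square_def chi_mult power_mult_distrib)

lemma signed_square_eq_0_iff [simp]: "signed_square x = 0 \<longleftrightarrow> x = 0"
  by (simp add: signed_square_def)

lemma count_signed_square_shift_one:
  "a \<noteq> 0 \<Longrightarrow> c_diff_count c signed_square a b = c_diff_count c signed_square 1 (b / signed_square a)"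
  by (rule c_diff_count_shift_one) (simp_all add: signed_square_mult)

section \<open>Classification of the solutions at shift 1\<close>

lemma solution_cases:
  assumes sol: "signed_square (x + 1) - c * signed_square x = b"
    and c: "c = 1 \<or> c = - 1" and x: "x \<noteq> 0" "x + 1 \<noteq> 0"
  obtains (linear) \<epsilon> where "\<epsilon> = 1 \<or> \<epsilon> = - 1" "x = 1 - \<epsilon> * b"
      "\<chi> (1 - \<epsilon> * b) = c * \<epsilon>" "\<chi> (1 + \<epsilon> * b) = \<chi> (- 1) * \<epsilon>"
    | (quadratic) \<epsilon> where "\<epsilon> = 1 \<or> \<epsilon> = - 1" "(x - 1)\<^sup>2 = - 1 - \<epsilon> * b"
      "\<chi> (x + 1) = \<epsilon>" "\<chi> x = - c * \<epsilon>"
      "\<chi> (1 - \<epsilon> * b) = - c" "\<chi> (1 + \<epsilon> * b) = 0 \<or> \<chi> (1 + \<epsilon> * b) = \<chi> (- 1)"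
proof -
  define \<epsilon> where "\<epsilon> = \<chi> (x + 1)"
  have eps: "\<epsilon> = 1 \<or> \<epsilon> = - 1"
    using chi_sign x(2) by (simp add: \<epsilon>_def)
  have cc: "c * c = 1" and ee: "\<epsilon> * \<epsilon> = 1"
    using c eps by auto
  define \<delta> where "\<delta> = \<chi> x"
  have b: "b = \<epsilon> * (x + 1)\<^sup>2 - c * \<delta> * x\<^sup>2"
    using sol by (simp add: signed_square_def \<epsilon>_def \<delta>_def mult.assoc)
  have eb: "\<epsilon> * b = (\<epsilon> * \<epsilon>) * (x + 1)\<^sup>2 - (\<epsilon> * (c * \<delta>)) * x\<^sup>2"
    unfolding b right_diff_distrib by (simp only: mult.assoc)
  \<comment> \<open>The sign of \<open>c * \<delta>\<close> relative to \<open>\<epsilon>\<close>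
    decides whether the two squares in \<open>\<epsilon> * b\<close> are subtracted, leaving a
    linear equation, or added.\<close>
  consider "\<delta> = c * \<epsilon>" | "\<delta> = - c * \<epsilon>"
    using c eps chi_sign[OF x(1)] by (auto simp: \<delta>_def)
  then show thesis
  proof cases
    case 1
    then have "c * \<delta> = \<epsilon>"
      using cc by (simp flip: mult.assoc)
    then have eb: "\<epsilon> * b = (x + 1)\<^sup>2 - x\<^sup>2"
      using eb ee by simp
    \<comment> \<open>In characteristic 3,
      \<open>(x + 1)^2 - x^2 = 2 * x + 1 = 1 - x\<close>.\<close>
    have lin: "x = 1 - \<epsilon> * b"
      by (rule eqI_mod_3[where k = x]) (use eb in algebra)
    have "1 + \<epsilon> * b = - (x + 1)"
      by (rule eqI_mod_3[where k = 1]) (use lin in algebra)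
    then have "\<chi> (1 + \<epsilon> * b) = \<chi> (- 1) * \<epsilon>"
      by (metis \<epsilon>_def chi_minus)
    then show thesis
      using linear eps lin 1 \<delta>_def by metis
  next
    case 2
    then have "c * \<delta> = - \<epsilon>"
      using cc by (simp flip: mult.assoc)
    then have eb: "\<epsilon> * b = (x + 1)\<^sup>2 + x\<^sup>2"
      using eb ee by simp
    have quad: "(x - 1)\<^sup>2 = - 1 - \<epsilon> * b"
      by (rule eqI_mod_3[where k = "x\<^sup>2 + 1"]) (use eb in algebra)
    \<comment> \<open>The sum of squares is \<open>2 * x * (x + 1) + 1\<close>, and -2 is 1. Hence
      the character of \<open>1 - \<epsilon> * b\<close> is the product of the two fixed
      signs.\<close>
    have prod: "1 - \<epsilon> * b = x * (x + 1)"
      by (rule eqI_mod_3[where k = "- x * (x + 1)"]) (use eb in algebra)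
    have P: "\<chi> (1 - \<epsilon> * b) = - c"
      unfolding prod chi_mult using 2 ee by (simp flip: \<epsilon>_def \<delta>_def)
    have "1 + \<epsilon> * b = - ((x - 1)\<^sup>2)"
      using quad by algebra
    then have "\<chi> (1 + \<epsilon> * b) = \<chi> (- 1) * \<chi> ((x - 1)\<^sup>2)"
      by (metis chi_minus)
    then have "\<chi> (1 + \<epsilon> * b) = 0 \<or> \<chi> (1 + \<epsilon> * b) = \<chi> (- 1)"
      by (cases "x = 1") auto
    then show thesis
      using quadratic eps quad 2 P \<epsilon>_def \<delta>_def by metis
  qed
qed

section \<open>Uniqueness when c equals the character of -1\<close>

lemma solution_unique:
  assumes c: "c = \<chi> (- 1)"
    and x: "signed_square (x + 1) - c * signed_square x = b"
    and y: "signed_square (y + 1) - c * signed_square y = b"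
  shows "x = y"
proof -
  have c1: "c = 1 \<or> c = - 1"
    using c chi_minus_1_sign by simp
  \<comment> \<open>The six kinds admit pairwise disjoint sets of pairs
    \<open>(\<chi> (1 - b), \<chi> (1 + b))\<close>, so two solutions for the same \<open>b\<close>
    are of the same kind. Only the two quadratic kinds then need a further argument.\<close>
  have kinds: "(z = 0 \<and> \<chi> (1 - b) = 0 \<and> \<chi> (1 + b) = c) \<or>
      (z = - 1 \<and> \<chi> (1 - b) = c \<and> \<chi> (1 + b) = 0) \<or>
      (z = 1 - b \<and> \<chi> (1 - b) = c \<and> \<chi> (1 + b) = c) \<or>
      (z = 1 + b \<and> \<chi> (1 - b) = - c \<and> \<chi> (1 + b) = - c) \<or>
      ((z - 1)\<^sup>2 = - 1 - b \<and> \<chi> (z + 1) = 1 \<and> \<chi> z = - c \<and>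
        \<chi> (1 - b) = - c \<and> (\<chi> (1 + b) = 0 \<or> \<chi> (1 + b) = c)) \<or>
      ((z - 1)\<^sup>2 = - 1 + b \<and> \<chi> (z + 1) = - 1 \<and> \<chi> z = c \<and>
        \<chi> (1 + b) = - c \<and> (\<chi> (1 - b) = 0 \<or> \<chi> (1 - b) = c))"
    (is "?K z") if z: "signed_square (z + 1) - c * signed_square z = b" for z
  proof -
    consider "z = 0" | "z + 1 = 0" | "z \<noteq> 0" "z + 1 \<noteq> 0" by blast
    then show ?thesis
    proof cases
      case 1
      then have "b = 1" using z by (simp add: signed_square_def)
      then show ?thesis using 1 c by simp
    next
      case 2
      then have zm: "z = - 1" by (simp add: eq_neg_iff_add_eq_0)
      then have "b = - 1" using z c c1 by (auto simp: signed_square_def)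
      then show ?thesis using zm c by simp
    next
      case 3
      show ?thesis
        using z c1 3
      proof (cases rule: solution_cases)
        case (linear \<epsilon>)
        from linear(1) show ?thesis
          by (elim disjE) (use linear(2-) in \<open>simp_all flip: c\<close>)
      next
        case (quadratic \<epsilon>)
        from quadratic(1) show ?thesis
          by (elim disjE) (use quadratic(2-) in \<open>simp_all flip: c\<close>)
      qed
    qed
  qed
  \<comment> \<open>Distinct roots satisfy \<open>x + y = 2\<close>, that is
    \<open>y = - (x + 1)\<close>. This gives \<open>\<chi> y = c * e\<close>, the opposite of the
    prescribed sign.\<close>
  have root_unique: "x = y" if "(x - 1)\<^sup>2 = (y - 1)\<^sup>2" "\<chi> (x + 1) = e" "\<chi> y = - c * e" "e \<noteq> 0" for e
  proof (rule ccontr)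
    assume "x \<noteq> y"
    then have "(x - 1) + (y - 1) = 0"
      using that(1) by (metis power2_eq_iff diff_add_cancel eq_neg_iff_add_eq_0)
    then have "y = - (x + 1)"
      by - (rule eqI_mod_3[where k = 1], algebra)
    then have "\<chi> y = c * e"
      using that(2) c chi_minus by metis
    with that(3,4) c1 show False by auto
  qed
  have "- c \<noteq> c" "c \<noteq> - c" "c \<noteq> 0" "0 \<noteq> c" "- c \<noteq> 0"
    using c1 by auto
  with kinds[OF x] kinds[OF y] root_unique[of 1] root_unique[of "- 1"] show ?thesis
    by (elim disjE conjE; simp)
qed

section \<open>Upper bounds when c is the opposite sign\<close>

text \<open>For this \<open>c\<close> both linear kinds force \<open>\<chi> (1 - b) = c\<close>,
  while the quadratic kinds force \<open>- c\<close>, or 0 in the case \<open>b = 1\<close>. So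
  \<open>\<chi> (1 - b)\<close> separates linear from quadratic solutions.\<close>

lemma solutions_kinds:
  assumes c: "c = - \<chi> (- 1)"
    and z: "signed_square (z + 1) - c * signed_square z = b"
  shows "(z \<in> {0, - 1} \<and> b = 1) \<or>
      (z \<in> {1 - b, 1 + b} \<and> \<chi> (1 - b) = c) \<or>
      ((z - 1)\<^sup>2 = - 1 - b \<and> \<chi> (z + 1) = 1 \<and> \<chi> z = - c \<and> \<chi> (1 - b) = - c) \<or>
      ((z - 1)\<^sup>2 = b - 1 \<and> \<chi> (z + 1) = - 1 \<and> \<chi> z = c \<and> (b = 1 \<or> \<chi> (1 - b) = - c))"
proof -
  have c1: "c = 1 \<or> c = - 1"
    using c chi_minus_1_sign by auto
  consider "z = 0" | "z + 1 = 0" | "z \<noteq> 0" "z + 1 \<noteq> 0" by blast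
  then show ?thesis
  proof cases
    case 1
    then show ?thesis using z by (simp add: signed_square_def)
  next
    case 2
    then have "z = - 1" by (simp add: eq_neg_iff_add_eq_0)
    then show ?thesis using z c chi_minus_1_sign by (auto simp: signed_square_def)
  next
    case 3
    show ?thesis
      using z c1 3
    proof (cases rule: solution_cases)
      case (linear \<epsilon>)
      then show ?thesis using c c1 by auto
    next
      case (quadratic \<epsilon>)
      then show ?thesis using c c1 by auto
    qed
  qed
qed

lemma c_diff_count_le_4:
  assumes c: "c = - \<chi> (- 1)"
  shows "c_diff_count c signed_square 1 b \<le> 4"
proof -
  define S where "S = {x. signed_square (x + 1) - c * signed_square x = b}"
  define R where "R d = {x :: 'a. (x - 1)\<^sup>2 = d}" for d
  have "- c \<noteq> c" "c \<noteq> 0"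
    using c chi_minus_1_sign by auto
  \<comment> \<open>Each case allows at most two explicit points, or the roots of the first
    quadratic, besides the roots of the second; each of the two parts has at most two
    elements.\<close>
  have "\<exists>A. card A \<le> 2 \<and> S \<subseteq> A \<union> R (b - 1)"
  proof (cases "b = 1")
    case True
    then have "S \<subseteq> {0, - 1} \<union> R (b - 1)"
      using solutions_kinds[OF c] \<open>c \<noteq> 0\<close> by (fastforce simp: S_def R_def)
    then show ?thesis
      by (intro exI[of _ "{0, - 1}"]) (simp add: card_insert_if)
  next
    case False
    show ?thesis
    proof (cases "\<chi> (1 - b) = c")
      case True
      then have "S \<subseteq> {1 - b, 1 + b} \<union> R (b - 1)"
        using solutions_kinds[OF c] False \<open>- c \<noteq> c\<close> by (fastforce simp: S_def R_def)
      then show ?thesis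
        by (intro exI[of _ "{1 - b, 1 + b}"]) (simp add: card_insert_if)
    next
      case ne: False
      then have "S \<subseteq> R (- 1 - b) \<union> R (b - 1)"
        using solutions_kinds[OF c] False by (fastforce simp: S_def R_def)
      then show ?thesis
        using card_square_roots_le_2 R_def by auto
    qed
  qed
  then obtain A where "card A \<le> 2" "S \<subseteq> A \<union> R (b - 1)" by blast
  moreover have "card (R (b - 1)) \<le> 2"
    unfolding R_def by (rule card_square_roots_le_2)
  ultimately have "card S \<le> 4"
    using card_mono[of "A \<union> R (b - 1)" S] card_Un_le[of A "R (b - 1)"] by simp
  then show ?thesis
    by (simp add: c_diff_count_def S_def)
qed

text \<open>On the circle, \<open>(1 + s + t)^2 = 2 * (1 + s) * (1 + t)\<close>, and 2 is -1. With
  \<open>\<chi> (- 1) = 1\<close> the product \<open>(1 + s) * (1 + t)\<close> therefore has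
  character 1. This is what keeps the two quadratic kinds from occurring together.\<close>

lemma chi_circle:
  assumes "s\<^sup>2 + t\<^sup>2 = 1" "\<chi> (- 1) = 1" "s \<noteq> - 1" "t \<noteq> - 1"
  shows "\<chi> (1 + s) = \<chi> (1 + t)"
proof -
  have "(1 + s) * (1 + t) = - ((1 + s + t)\<^sup>2)"
    by (rule eqI_mod_3[where k = "(1 + s) * (1 + t)"]) (use assms(1) in algebra)
  moreover have "1 + s \<noteq> 0" "1 + t \<noteq> 0"
    using assms(3,4) by (auto simp: add_eq_0_iff)
  moreover from calculation have "1 + s + t \<noteq> 0"
    by auto
  ultimately have "\<chi> (1 + s) * \<chi> (1 + t) = 1"
    using assms(2) by (simp add: chi_minus[of "(1 + s + t)\<^sup>2"] flip: chi_mult)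
  then show ?thesis
    using chi_sign[OF \<open>1 + s \<noteq> 0\<close>] chi_sign[OF \<open>1 + t \<noteq> 0\<close>] by auto
qed

lemma c_diff_count_le_2:
  assumes m: "\<chi> (- 1) = 1"
  shows "c_diff_count (- 1) signed_square 1 b \<le> 2"
proof -
  define S where "S = {x. signed_square (x + 1) - - 1 * signed_square x = b}"
  define R where "R d = {x :: 'a. (x - 1)\<^sup>2 = d}" for d
  have c: "- 1 = - \<chi> (- 1)"
    using m by simp
  have "\<exists>A. card A \<le> 2 \<and> S \<subseteq> A"
  proof (cases "b = 1")
    case True
    \<comment> \<open>The second quadratic becomes \<open>(z - 1)^2 = 0\<close>; its root 1 has
      character 1, whereas this kind requires -1.\<close>
    have "S \<subseteq> {0, - 1}"
      using solutions_kinds[OF c] True by (fastforce simp: S_def)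
    then show ?thesis
      by (intro exI[of _ "{0, - 1}"]) (simp add: card_insert_if)
  next
    case False
    show ?thesis
    proof (cases "\<chi> (1 - b) = - 1")
      case True
      then have "S \<subseteq> {1 - b, 1 + b}"
        using solutions_kinds[OF c] False by (fastforce simp: S_def)
      then show ?thesis
        by (intro exI[of _ "{1 - b, 1 + b}"]) (simp add: card_insert_if)
    next
      case ne: False
      have kinds: "((z - 1)\<^sup>2 = - 1 - b \<and> \<chi> z = 1) \<or> ((z - 1)\<^sup>2 = b - 1 \<and> \<chi> z = - 1)"
        if "z \<in> S" for z
        using solutions_kinds[OF c, of z b] that ne False by (auto simp: S_def)
      have excl: False if "(x - 1)\<^sup>2 = - 1 - b" "\<chi> x = 1" "(y - 1)\<^sup>2 = b - 1" "\<chi> y = - 1" for x y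
      proof -
        \<comment> \<open>The sum of the two right-hand sides is -2, which is 1, so
          \<open>(x - 1, y - 1)\<close> lies on the circle.\<close>
        have "(x - 1)\<^sup>2 + (y - 1)\<^sup>2 = 1"
          by (simp add: that(1,3))
        then have "\<chi> (1 + (x - 1)) = \<chi> (1 + (y - 1))"
          by (rule chi_circle[OF _ m]) (use that(2,4) in auto)
        then show False
          using that(2,4) by simp
      qed
      have "S \<subseteq> R (- 1 - b) \<or> S \<subseteq> R (b - 1)"
        using kinds excl by (simp add: R_def subset_iff) metis
      then show ?thesis
        using card_square_roots_le_2 R_def by auto
    qed
  qed
  then have "card S \<le> 2"
    by (meson card_mono finite order_trans)
  then show ?thesis
    by (simp add: c_diff_count_def S_def)
qed

section \<open>The shift 0\<close>

text \<open>For nonzero \<open>x\<close> and \<open>y\<close> of opposite characters,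
  \<open>x^2 = - y^2\<close>. This gives \<open>\<chi> (- 1) = 1\<close> and
  \<open>(x + y)^2 = 2 * x * y = - x * y\<close>, hence \<open>\<chi> (x * y) = 1\<close>, a
  contradiction.\<close>

lemma signed_square_eqD:
  assumes eq: "signed_square x = signed_square y"
  shows "x = y \<or> (x = - y \<and> \<chi> x = \<chi> y)"
proof (cases "x = 0 \<or> y = 0")
  case True
  then show ?thesis
    using eq by (metis signed_square_eq_0_iff)
next
  case False
  then have nz: "x \<noteq> 0" "y \<noteq> 0" by auto
  show ?thesis
  proof (cases "\<chi> x = \<chi> y")
    case True
    then show ?thesis
      using eq nz by (simp add: signed_square_def power2_eq_iff)
  next
    case False
    have opp: "\<chi> x = - \<chi> y"
      using chi_sign[OF nz(1)] chi_sign[OF nz(2)] False by auto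
    then have "\<chi> y * x\<^sup>2 = \<chi> y * - (y\<^sup>2)"
      using eq unfolding signed_square_def
      by (metis minus_minus mult_minus_left mult_minus_right)
    then have sq: "x\<^sup>2 = - (y\<^sup>2)"
      using nz by (simp only: mult_cancel_left chi_eq_0_iff) simp
    then have "\<chi> (- 1) = 1"
      by (metis chi_minus chi_square mult.right_neutral nz)
    moreover have "x * y = - ((x + y)\<^sup>2)"
      by (rule eqI_mod_3[where k = "x * y"]) (use sq in algebra)
    ultimately have "\<chi> x * \<chi> y = 1"
      by (metis chi_minus chi_mult chi_square mult.right_neutral mult_eq_0_iff
          neg_equal_0_iff_equal nz zero_eq_power2)
    then show ?thesis
      using opp chi_sign[OF nz(1)] by (metis minus_minus one_neq_minus_one(2) mult_minus_left mult_minus_right mult.left_neutral)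
  qed
qed

lemma count_shift_zero:
  fixes b :: 'a
  shows "{x :: 'a. signed_square (x + 0) - - 1 * signed_square x = b} = {x. signed_square x = - b}"
proof -
  have "g + g = - g" for g :: 'a
    by (rule eqI_mod_3[where k = g]) simp
  then have "g + g = b \<longleftrightarrow> g = - b" for g :: 'a
    by (metis minus_minus)
  then show ?thesis by simp
qed

section \<open>A value attained four times\<close>

lemma four_solutions:
  fixes w :: 'a
  assumes m: "\<chi> (- 1) = - 1" and w: "w \<noteq> 0" "w \<noteq> 1" "w \<noteq> - 1"
  obtains b where "4 \<le> c_diff_count 1 signed_square 1 b"
proof -
  define w' where "w' = inverse w"
  \<comment> \<open>In characteristic 3, \<open>v\<^sup>2 = u\<^sup>2 + 1\<close>; then \<open>((1 - u\<^sup>2) / v\<^sup>2, 2 * u / v\<^sup>2)\<close> lies on the circle.\<close>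
  define u v where "u = w' - w" and "v = - (w + w')"
  \<comment> \<open>That -1 is not a square makes \<open>v\<close>, \<open>1 + u\<close> and
    \<open>1 - u\<close> nonzero and separates \<open>s\<close> and \<open>- s\<close> from
    \<open>t\<close> and \<open>- t\<close>.\<close>
  have nonsq: "x\<^sup>2 \<noteq> - 1" for x :: 'a
  proof
    assume sq: "x\<^sup>2 = - 1"
    then have "x \<noteq> 0" by auto
    then show False
      using chi_square[of x] m unfolding sq by simp
  qed
  have inv: "w * w' = 1"
    using w by (simp add: w'_def)
  have vu: "v\<^sup>2 = u\<^sup>2 + 1"
    unfolding u_def v_def by (rule eqI_mod_3[where k = 1]) (use inv in algebra)
  have "v \<noteq> 0"
    using vu nonsq[of u] by (auto simp: eq_neg_iff_add_eq_0)
  have "u \<noteq> 0"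
  proof
    assume "u = 0"
    then have "w\<^sup>2 = 1"
      using inv unfolding u_def by algebra
    with w show False
      by (simp add: power2_eq_1_iff)
  qed
  have "u\<^sup>2 \<noteq> 1"
  proof
    assume "u\<^sup>2 = 1"
    then have "v\<^sup>2 = - 1"
      using vu by - (rule eqI_mod_3[where k = 1], algebra)
    with nonsq show False by blast
  qed
  define i where "i = inverse v"
  have i: "v * i = 1"
    using \<open>v \<noteq> 0\<close> by (simp add: i_def)
  then have "i \<noteq> 0" by auto
  \<comment> \<open>The second coordinate is \<open>2 * u / v^2\<close>, with 2 replaced by
    -1.\<close>
  define s t where "s = (1 - u\<^sup>2) * i\<^sup>2" and "t = - u * i\<^sup>2"
  have "s \<noteq> 0" "t \<noteq> 0"
    using \<open>u \<noteq> 0\<close> \<open>u\<^sup>2 \<noteq> 1\<close> \<open>i \<noteq> 0\<close> by (auto simp: s_def t_def)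
  have circle: "s\<^sup>2 + t\<^sup>2 = 1"
    unfolding s_def t_def
    by (rule eqI_mod_3[where k = "- (u\<^sup>2) * i ^ 4"]) (use vu i in algebra)
  have "s\<^sup>2 \<noteq> t\<^sup>2"
  proof
    assume "s\<^sup>2 = t\<^sup>2"
    then have "s\<^sup>2 = - 1"
      using circle by - (rule eqI_mod_3[where k = "s\<^sup>2"], algebra)
    with nonsq show False by blast
  qed
  then have "s \<noteq> t" "s \<noteq> - t" by auto
  \<comment> \<open>Here \<open>s + 1 = 2 / v^2\<close> and \<open>s - 1 = - 2 * u^2 / v^2\<close>;
    for \<open>t\<close> below, adding or subtracting 1 likewise gives a square up to sign.\<close>
  have chi_s: "\<chi> (s + 1) = - 1" "\<chi> (s - 1) = 1"
  proof -
    have "s + 1 = - (i\<^sup>2)"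
      unfolding s_def by (rule eqI_mod_3[where k = "i\<^sup>2"]) (use vu i in algebra)
    moreover have "s - 1 = (u * i)\<^sup>2"
      unfolding s_def by (rule eqI_mod_3[where k = "- (u\<^sup>2) * i\<^sup>2"]) (use vu i in algebra)
    ultimately show "\<chi> (s + 1) = - 1" "\<chi> (s - 1) = 1"
      using \<open>i \<noteq> 0\<close> \<open>u \<noteq> 0\<close> m chi_minus[of "i\<^sup>2"] by simp_all
  qed
  have chi_t: "\<chi> (t + 1) = 1" "\<chi> (t - 1) = - 1"
  proof -
    have "t + 1 = ((1 + u) * i)\<^sup>2"
      unfolding t_def by (rule eqI_mod_3[where k = "- u * i\<^sup>2"]) (use vu i in algebra)
    moreover have "t - 1 = - (((1 - u) * i)\<^sup>2)"
      unfolding t_def by (rule eqI_mod_3[where k = "- u * i\<^sup>2"]) (use vu i in algebra)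
    moreover have "1 + u \<noteq> 0" "1 - u \<noteq> 0"
      using \<open>u\<^sup>2 \<noteq> 1\<close> by (auto simp: power2_eq_1_iff add_eq_0_iff)
    ultimately show "\<chi> (t + 1) = 1" "\<chi> (t - 1) = - 1"
      using \<open>i \<noteq> 0\<close> m chi_minus[of "((1 - u) * i)\<^sup>2"] by simp_all
  qed
  \<comment> \<open>Centring at 1 makes the situation symmetric: for \<open>x = 1 + r\<close> the
    arguments are \<open>r - 1\<close> and \<open>r + 1\<close>, and by \<open>neg\<close> below the
    sign conditions are invariant under \<open>r\<close> to \<open>- r\<close>.\<close>
  have sol: "signed_square ((1 + r) + 1) - 1 * signed_square (1 + r) = e * (- 1 - r\<^sup>2)"
    if "\<chi> (r + 1) = - e" "\<chi> (r - 1) = e" for r e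
  proof -
    have "(1 + r) + 1 = r - 1"
      by (rule eqI_mod_3[where k = 1]) simp
    then have "signed_square ((1 + r) + 1) - 1 * signed_square (1 + r) =
        e * (r - 1)\<^sup>2 - (- e) * (r + 1)\<^sup>2"
      using that by (simp add: signed_square_def add.commute)
    also have "\<dots> = e * (- 1 - r\<^sup>2)"
      by (rule eqI_mod_3[where k = "e * (1 + r\<^sup>2)"]) algebra
    finally show ?thesis .
  qed
  have neg: "\<chi> (- r + 1) = - \<chi> (r - 1)" "\<chi> (- r - 1) = - \<chi> (r + 1)" for r
  proof -
    have "- r + 1 = - (r - 1)" "- r - 1 = - (r + 1)"
      by simp_all
    then show "\<chi> (- r + 1) = - \<chi> (r - 1)" "\<chi> (- r - 1) = - \<chi> (r + 1)"
      using m by (metis chi_minus mult_minus1)+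
  qed
  define b where "b = - 1 - s\<^sup>2"
  \<comment> \<open>The pairs belonging to \<open>s\<close> (sign 1) and to \<open>t\<close> (sign
    -1) reach the same value exactly because \<open>s^2 + t^2 = 1 = - 2\<close>.\<close>
  have bt: "b = - 1 * (- 1 - t\<^sup>2)"
    unfolding b_def by (rule eqI_mod_3[where k = "- 1"]) (use circle in algebra)
  have "signed_square ((1 + r) + 1) - 1 * signed_square (1 + r) = b" if "r = s \<or> r = - s" for r
    using that sol[of r 1] neg[of s] chi_s by (auto simp: b_def)
  moreover have "signed_square ((1 + r) + 1) - 1 * signed_square (1 + r) = b" if "r = t \<or> r = - t" for r
    using that sol[of r "- 1"] neg[of t] chi_t by (auto simp: bt)
  ultimately have "{1 + s, 1 + - s, 1 + t, 1 + - t} \<subseteq>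
      {x. signed_square (x + 1) - 1 * signed_square x = b}"
    by blast
  then have "card {1 + s, 1 + - s, 1 + t, 1 + - t} \<le> c_diff_count 1 signed_square 1 b"
    unfolding c_diff_count_def by (rule card_mono[rotated]) simp
  moreover have "r \<noteq> - r" if "r \<noteq> 0" for r :: 'a
  proof
    assume "r = - r"
    then have "r = 0"
      by - (rule eqI_mod_3[where k = r], algebra)
    with that show False by simp
  qed
  then have "card {1 + s, 1 + - s, 1 + t, 1 + - t} = 4"
    using \<open>s \<noteq> 0\<close> \<open>t \<noteq> 0\<close> \<open>s \<noteq> t\<close> \<open>s \<noteq> - t\<close> by (auto simp: card_insert_if)
  ultimately show thesis
    using that by simp
qed

section \<open>The uniformities in terms of the character of -1\<close>

lemma uniformity_eq_1:
  assumes c: "c = \<chi> (- 1)"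
  shows "c_diff_uniformity c signed_square = 1"
proof (rule c_diff_uniformity_eqI)
  show "c_diff_count c signed_square a b \<le> 1" if "c = 1 \<Longrightarrow> a \<noteq> 0" for a b
  proof (cases "a = 0")
    case True
    then have "c = - 1"
      using that c chi_minus_1_sign by auto
    have "x = y" if "signed_square x = - b" "signed_square y = - b" for x y
    proof -
      have "signed_square x = signed_square y"
        using that by simp
      \<comment> \<open>Now \<open>\<chi>\<close> is odd, so equal characters at \<open>y\<close>
        and \<open>- y\<close> leave only \<open>y = 0\<close>.\<close>
      moreover have "x = y" if "x = - y" "\<chi> x = \<chi> y"
        using that chi_minus[of y] c \<open>c = - 1\<close> by (cases "y = 0") (use chi_sign[of y] in auto)
      ultimately show ?thesis
        using signed_square_eqD by blast
    qed
    then show ?thesis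
      unfolding c_diff_count_def True \<open>c = - 1\<close> count_shift_zero
      by (intro card_le_one_if_unique) auto
  next
    case False
    show ?thesis
      unfolding count_signed_square_shift_one[OF False] unfolding c_diff_count_def
      by (rule card_le_one_if_unique) (auto intro: solution_unique[OF c])
  qed
  have "0 \<in> {x. signed_square (x + 1) - c * signed_square x = 1}"
    by (simp add: signed_square_def)
  then show "1 \<le> c_diff_count c signed_square 1 1"
    unfolding c_diff_count_def by (metis One_nat_def Suc_leI card_gt_0_iff empty_iff finite)
qed simp

lemma uniformity_minus_1_eq_2:
  assumes m: "\<chi> (- 1) = 1"
  shows "c_diff_uniformity (- 1) signed_square = 2"
proof (rule c_diff_uniformity_eqI)
  show "c_diff_count (- 1) signed_square a b \<le> 2" for a b
  proof (cases "a = 0")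
    case True
    have "card {x. signed_square x = - b} \<le> 2"
    proof (cases "\<exists>y. signed_square y = - b")
      case True
      then obtain y where "signed_square y = - b" by blast
      then have "{x. signed_square x = - b} \<subseteq> {y, - y}"
        using signed_square_eqD by (metis (mono_tags, lifting) insertCI mem_Collect_eq subsetI)
      then have "card {x. signed_square x = - b} \<le> card {y, - y}"
        by (rule card_mono[rotated]) simp
      then show ?thesis
        by (simp add: card_insert_if split: if_splits)
    qed simp
    then show ?thesis
      unfolding c_diff_count_def True count_shift_zero .
  next
    case False
    show ?thesis
      unfolding count_signed_square_shift_one[OF False] by (rule c_diff_count_le_2[OF m])
  qed
  have "{0, - 1} \<subseteq> {x. signed_square (x + 1) - - 1 * signed_square x = 1}"
    using m by (simp add: signed_square_def)
  then have "card {0, - 1 :: 'a} \<le> c_diff_count (- 1) signed_square 1 1"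
    unfolding c_diff_count_def by (rule card_mono[rotated]) simp
  then show "2 \<le> c_diff_count (- 1) signed_square 1 1"
    by simp
qed simp

lemma uniformity_1_eq_4:
  assumes m: "\<chi> (- 1) = - 1" and card: "3 < CARD('a)"
  shows "c_diff_uniformity 1 signed_square = 4"
proof -
  have "\<exists>w. w \<notin> {0, 1, - 1 :: 'a}"
  proof (rule ccontr)
    assume "\<nexists>w. w \<notin> {0, 1, - 1 :: 'a}"
    then have "CARD('a) = card {0, 1, - 1 :: 'a}"
      by (metis UNIV_eq_I)
    with card show False
      by simp
  qed
  then obtain b where b: "4 \<le> c_diff_count 1 signed_square 1 b"
    using four_solutions[OF m] by auto
  show ?thesis
  proof (rule c_diff_uniformity_eqI)
    show "c_diff_count 1 signed_square a b \<le> 4" if "1 = (1 :: 'a) \<Longrightarrow> a \<noteq> 0" for a b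
      using that count_signed_square_shift_one[of a 1 b] c_diff_count_le_4[of 1] m by simp
  qed (use b in auto)
qed

end

section \<open>Specialisation to the power function\<close>

theorem theorem8:
  fixes G :: "'a::{field,finite} \<Rightarrow> 'a" and n :: nat
  assumes "n \<ge> 2"
    and "CARD('a) = 3 ^ n"
    and "\<And>x. G x = x ^ ((3 ^ n + 3) div 2)"
  shows "(odd n \<longrightarrow> PcN (- 1) G) \<and>
         (even n \<longrightarrow> APcN (- 1) G) \<and>
         (even n \<longrightarrow> c_diff_uniformity 1 G = 1) \<and>
         (odd n \<longrightarrow> c_diff_uniformity 1 G = 4)"
proof -
  define k :: nat where "k = (3 ^ n - 1) div 2"
  \<comment> \<open>The parity of \<open>(3 ^ n - 1) div 2\<close> is that of \<open>n\<close>, so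
    \<open>\<chi> (- 1)\<close> is 1 for even \<open>n\<close> and -1 for odd
    \<open>n\<close>.\<close>
  have half: "\<exists>j. (3 :: nat) ^ i = 2 * j + 1 \<and> (even j \<longleftrightarrow> even i)" for i
  proof (induction i)
    case (Suc i)
    then obtain j where "(3 :: nat) ^ i = 2 * j + 1" "even j \<longleftrightarrow> even i" by blast
    then show ?case
      by (intro exI[of _ "3 * j + 1"]) auto
  qed simp
  obtain j where "(3 :: nat) ^ n = 2 * j + 1" "even j \<longleftrightarrow> even n"
    using half by blast
  then have k: "3 ^ n = 2 * k + 1" and k_parity: "even k \<longleftrightarrow> even n"
    by (simp_all add: k_def)
  \<comment> \<open>The bound \<open>n \<ge> 2\<close> provides an element other than 0, 1 and -1,
    from which the four solutions are built.\<close>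
  have "(3 :: nat) ^ 2 \<le> 3 ^ n"
    using assms(1) by (intro power_increasing) auto
  then have "k > 0" and card: "3 < CARD('a)"
    using k assms(2) by auto
  define \<chi> :: "'a \<Rightarrow> 'a" where "\<chi> x = x ^ k" for x
  interpret ternary_quadratic_character \<chi>
  proof
    have "(3 :: 'a) ^ n = 0"
      using of_nat_CARD_eq_0[where 'a = 'a] assms(2) by simp
    then show "(3 :: 'a) = 0" by simp
    show "\<chi> 0 = 0"
      using \<open>k > 0\<close> by (simp add: \<chi>_def)
    \<comment> \<open>The square of \<open>x ^ k\<close> is
      \<open>x ^ (3 ^ n - 1) = 1\<close>.\<close>
    show "\<chi> x = 1 \<or> \<chi> x = - 1" if "x \<noteq> 0" for x
      using finite_field_power_card_minus_one[OF that] assms(2) k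
      by (simp add: \<chi>_def power_mult mult.commute[of 2 k] power2_eq_1_iff)
  qed (simp add: \<chi>_def power_mult_distrib)
  have G: "G = signed_square"
  proof
    have "(3 ^ n + 3) div 2 = k + 2"
      using k by simp
    then show "G x = signed_square x" for x
      by (simp add: assms(3) signed_square_def \<chi>_def power_add power2_eq_square)
  qed
  show ?thesis
  proof (cases "even n")
    case True
    then have "\<chi> (- 1) = 1"
      using k_parity by (simp add: \<chi>_def)
    then show ?thesis
      using True uniformity_eq_1[of 1] uniformity_minus_1_eq_2 by (simp add: G APcN_def)
  next
    case False
    then have "\<chi> (- 1) = - 1"
      using k_parity by (simp add: \<chi>_def)
    then show ?thesis
      using False uniformity_eq_1[of "- 1"] uniformity_1_eq_4[OF _ card] by (simp add: G PcN_def)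
  qed
qed

end
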